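(* Let $\{\Lambda_i\}_{i\in\mathbb N}$ and $\{\Gamma_i\}_{i\in\mathbb N}$ be g-Riesz basis sequences in $\mathcal H$ with bounds $A_1,B_1$ and $A_2,B_2$, respectively. Then the following are equivalent: (1) There exist constants $0<B\le C<\infty$ such that for every $\sigma\subset\mathbb N$ the family $\{\Lambda_i\}_{i\in\sigma}\cup\{\Gamma_i\}_{i\in\sigma^c}$ is a g-Riesz basis sequence with bounds $B,C$. (2) There is a constant $A>0$ such that for all $\{g_i\}_{i\in\mathbb N}\in\oplus_{i\in\mathbb N}\mathcal H_i$ and all $\sigma\subset\mathbb N$, $$A\Big\|\sum_{i\in\sigma}\Lambda_i^*g_i\Big\|^2\le\Big\|\sum_{i\in\sigma}\Lambda_i^*g_i+\sum_{i\in\sigma^c}\Gamma_i^*g_i\Big\|^2.$$ (3) There is a constant $D>0$ such that for all $\{g_i\}_{i\in\mathbb N}\in\oplus_{i\in\mathbb N}\mathcal H_i$ and all $\sigma\subset\mathbb N$, $$D\Big(\Big\|\sum_{i\in\sigma}\Lambda_i^*g_i\Big\|^2+\Big\|\sum_{i\in\sigma^c}\Gamma_i^*g_i\Big\|^2\Big)\le\Big\|\sum_{i\in\sigma}\Lambda_i^*g_i+\sum_{i\in\sigma^c}\Gamma_i^*g_i\Big\|^2.$$ (4) There is a constant $E>0$ such that for all $\{g_i\}_{i\in\mathbb N}\in\oplus_{i\in\mathbb N}\mathcal H_i$ and all $\sigma\subset\mathbb N$, if $\|\sum_{i\in\sigma}\Lambda_i^*g_i\|=1$, then $$E\le\Bi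g\|\sum_{i\in\sigma}\Lambda_i^*g_i+\sum_{i\in\sigma^c}\Gamma_i^*g_i\Big\|^2.$$
   Context: $\mathcal H$ and $\mathcal K$ are Hilbert spaces, $\{\mathcal H_i\}_{i\in\mathbb N}$ is a sequence of closed subspaces of $\mathcal K$, $\Lambda_i,\Gamma_i\in L(\mathcal H,\mathcal H_i)$ are bounded linear operators, and $\sigma^c=\mathbb N\setminus\sigma$. $\oplus_{i\in\mathbb N}\mathcal H_i=\{\{g_i\}_{i\in\mathbb N}: g_i\in\mathcal H_i,\ \sum_i\|g_i\|^2<\infty\}$. A family $\{\Theta_i\}_{i\in\mathbb N}$, $\Theta_i\in L(\mathcal H,\mathcal H_i)$, is a g-Riesz basis sequence (g-Riesz sequence) with bounds $0<C\le D<\infty$ if for every finite $J\subset\mathbb N$ and all $g_i\in\mathcal H_i$, $C\sum_{i\in J}\|g_i\|^2\le\|\sum_{i\in J}\Theta_i^*g_i\|^2\le D\sum_{i\in J}\|g_i\|^2$ (no completeness is required). The family $\{\Lambda_i\}_{i\in\sigma}\cup\{\Gamma_i\}_{i\in\sigma^c}$ is the family whose $i$-th member is $\Lambda_i$ if $i\in\sigma$ and $\Gamma_i$ if $i\in\sigma^c$. *)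

theory Defs
  imports "HOL-Analysis.Analysis"
begin

text \<open>
  Scalars: a single class with the instances \<^typ>\<open>real\<close> and \<^typ>\<open>complex\<close>, so that Hilbert
  spaces over both fields are treated at once.
\<close>

class hilbert_scalar = real_normed_field +
  fixes conjugate :: "'a \<Rightarrow> 'a"
  assumes conjugate_add: "conjugate (a + b) = conjugate a + conjugate b"
    and conjugate_mult: "conjugate (a * b) = conjugate a * conjugate b"
    and conjugate_conjugate: "conjugate (conjugate a) = a"
    and mult_conjugate: "a * conjugate a = (norm a)\<^sup>2 *\<^sub>R 1"

instantiation real :: hilbert_scalar
begin

definition conjugate_real :: "real \<Rightarrow> real" where
  "conjugate_real a = a"

instance
  by standard (simp_all add: conjugate_real_def power2_eq_square)

end

instantiation complex :: hilbert_scalar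
begin

definition conjugate_complex :: "complex \<Rightarrow> complex" where
  "conjugate_complex a = cnj a"

instance
  by standard (simp_all add: conjugate_complex_def scaleR_conv_of_real complex_norm_square del: of_real_power)

end

text \<open>
  The norm and the topology of a Hilbert space are those of its type, tied to the inner product
  by \<open>ip_norm\<close>, which also contains positive definiteness; completeness is the class \<open>banach\<close>.
  The inner product is linear in its first argument.
\<close>

locale hilbert_space = vector_space scl
  for scl :: "'f::hilbert_scalar \<Rightarrow> 'v::banach \<Rightarrow> 'v" +
  fixes ip :: "'v \<Rightarrow> 'v \<Rightarrow> 'f"
  assumes scaleR_scale: "r *\<^sub>R x = scl (of_real r) x"
    and ip_add: "ip (x + y) z = ip x z + ip y z"
    and ip_scale: "ip (scl a x) y = a * ip x y"
    and ip_conjugate: "ip y x = conjugate (ip x y)"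
    and ip_norm: "ip x x = of_real ((norm x)\<^sup>2)"

lemma hilbert_space_real:
  "hilbert_space scaleR (inner :: 'v::{real_inner, banach} \<Rightarrow> 'v \<Rightarrow> real)"
  by unfold_locales
    (simp_all add: algebra_simps conjugate_real_def inner_commute power2_norm_eq_inner)

lemma hilbert_space_complex:
  "hilbert_space (*) (\<lambda>x y :: complex. x * cnj y)"
  by unfold_locales
    (simp_all add: algebra_simps conjugate_complex_def scaleR_conv_of_real complex_norm_square
      del: of_real_power)

definition closed_subspace ::
    "('f::hilbert_scalar \<Rightarrow> 'v::banach \<Rightarrow> 'v) \<Rightarrow> 'v set \<Rightarrow> bool" where
  "closed_subspace scl V \<longleftrightarrow> module.subspace scl V \<and> closed V"

text \<open>
  The space $L(H, V)$ for a closed subspace \<open>V\<close> of \<open>K\<close>. The predicate \<^const>\<open>bounded_linear\<close>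
  only knows about real scalars; linearity over the scalar field is the first conjunct.
\<close>

definition bounded_operators ::
    "('f::hilbert_scalar \<Rightarrow> 'h::banach \<Rightarrow> 'h) \<Rightarrow> ('f \<Rightarrow> 'k::banach \<Rightarrow> 'k) \<Rightarrow> 'k set
      \<Rightarrow> ('h \<Rightarrow> 'k) set" where
  "bounded_operators scaleH scaleK V =
    {T. Vector_Spaces.linear scaleH scaleK T \<and> bounded_linear T \<and> range T \<subseteq> V}"

text \<open>
  For \<open>T\<close> in $L(H, V)$ the adjoint is a map from \<open>V\<close> to \<open>H\<close>; as the inner product of \<open>V\<close> is
  that of \<open>K\<close>, \<open>V\<close> need not occur in the definition. It is only ever applied to \<open>g \<in> V\<close>, and
  the \<open>y\<close> exists uniquely by the Riesz representation theorem.
\<close>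

definition hilbert_adjoint ::
    "('h \<Rightarrow> 'h \<Rightarrow> 'f::hilbert_scalar) \<Rightarrow> ('k \<Rightarrow> 'k \<Rightarrow> 'f) \<Rightarrow> ('h::banach \<Rightarrow> 'k::banach) \<Rightarrow> 'k \<Rightarrow> 'h" where
  "hilbert_adjoint ipH ipK T g = (THE y. \<forall>x. ipK (T x) g = ipH x y)"

definition l2_direct_sum :: "(nat \<Rightarrow> 'k::banach set) \<Rightarrow> (nat \<Rightarrow> 'k) set" where
  "l2_direct_sum V = {g. (\<forall>i. g i \<in> V i) \<and> summable (\<lambda>i. (norm (g i))\<^sup>2)}"

definition g_riesz_sequence ::
    "('h \<Rightarrow> 'h \<Rightarrow> 'f::hilbert_scalar) \<Rightarrow> ('k \<Rightarrow> 'k \<Rightarrow> 'f) \<Rightarrow> (nat \<Rightarrow> 'k set)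
      \<Rightarrow> (nat \<Rightarrow> 'h::banach \<Rightarrow> 'k::banach) \<Rightarrow> real \<Rightarrow> real \<Rightarrow> bool" where
  "g_riesz_sequence ipH ipK V \<Theta> C D \<longleftrightarrow>
    0 < C \<and> C \<le> D \<and>
    (\<forall>J g. finite J \<longrightarrow> (\<forall>i\<in>J. g i \<in> V i) \<longrightarrow>
      C * (\<Sum>i\<in>J. (norm (g i))\<^sup>2) \<le> (norm (\<Sum>i\<in>J. hilbert_adjoint ipH ipK (\<Theta> i) (g i)))\<^sup>2 \<and>
      (norm (\<Sum>i\<in>J. hilbert_adjoint ipH ipK (\<Theta> i) (g i)))\<^sup>2 \<le> D * (\<Sum>i\<in>J. (norm (g i))\<^sup>2))"

text \<open>
  The sum over the indices in \<open>\<sigma>\<close> of the vectors \<open>\<Theta>\<^sub>i\<^sup>* g\<^sub>i\<close>. The series is unordered; it converges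
  unconditionally whenever \<open>\<Theta>\<close> is a g-Riesz sequence and \<open>g\<close> lies in the direct sum.
\<close>

definition synthesis ::
    "('h \<Rightarrow> 'h \<Rightarrow> 'f::hilbert_scalar) \<Rightarrow> ('k \<Rightarrow> 'k \<Rightarrow> 'f) \<Rightarrow> (nat \<Rightarrow> 'h::banach \<Rightarrow> 'k::banach)
      \<Rightarrow> nat set \<Rightarrow> (nat \<Rightarrow> 'k) \<Rightarrow> 'h" where
  "synthesis ipH ipK \<Theta> \<sigma> g = (\<Sum>\<^sub>\<infinity>i\<in>\<sigma>. hilbert_adjoint ipH ipK (\<Theta> i) (g i))"

end

theory Submission
  imports Defs
begin

text \<open>
  A g-Riesz bound turns the norm of a synthesized vector into the norm of its coefficients, so each
  of the four conditions says that the square sum of the coefficients is controlled by the norm of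
  the mixed sum: the part over \<open>\<sigma>\<close> is bounded by \<open>B\<^sub>1\<close> times the square sum, which gives
  (1) to (2); the part over the complement is recovered from (2) by the triangle inequality, which
  gives (3); and testing (3) on finitely supported families gives the lower bound in (1). Condition
  (4) is (2) on normalized vectors.
\<close>

section \<open>Conjugation of real scalars and the inner product in its second argument\<close>

text \<open>The axiom \<open>mult_conjugate\<close> turns r times its conjugate into r squared, and
  a nonzero r cancels; additivity settles r = 0.\<close>

lemma conjugate_of_real: "conjugate (of_real r :: 'f::hilbert_scalar) = of_real r"
proof (cases "r = 0")
  case True
  have "conjugate (0::'f) = 0"
    using conjugate_add[of "0::'f" 0] by simp
  then show ?thesis
    using True by simp
next
  case False
  have "of_real r * conjugate (of_real r :: 'f) = of_real r * of_real r"
    by (simp add: mult_conjugate scaleR_conv_of_real power2_eq_square flip: of_real_mult)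
  then show ?thesis
    using False by simp
qed

context hilbert_space
begin

lemma ip_add_right: "ip x (y + z) = ip x y + ip x z"
  by (metis ip_add ip_conjugate conjugate_add)

lemma ip_scaleR_right: "ip x (r *\<^sub>R y) = of_real r * ip x y"
  by (metis ip_scale scaleR_scale ip_conjugate conjugate_mult conjugate_of_real)

lemma ip_zero_right: "ip x 0 = 0"
  using ip_scaleR_right[of x 0 0] by simp

text \<open>Testing against \<open>y - z\<close> and using positive definiteness gives uniqueness of
  representing vectors, which the definite description in \<open>hilbert_adjoint\<close> relies
  on.\<close>

lemma ip_right_eqI:
  assumes "\<And>x. ip x y = ip x z"
  shows "y = z"
proof -
  have "ip (y - z) (y - z) + ip (y - z) z = ip (y - z) y"
    using ip_add_right[of "y - z" "y - z" z] by simp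
  then have "ip (y - z) (y - z) = 0"
    using assms[of "y - z"] by simp
  then show ?thesis
    by (simp add: ip_norm)
qed

end

section \<open>Adjoints of the members of a g-Riesz sequence\<close>

lemma hilbert_adjoint_eqI:
  assumes "hilbert_space scaleH ipH" and "\<And>x. ipK (T x) g = ipH x y"
  shows "hilbert_adjoint ipH ipK T g = y"
  unfolding hilbert_adjoint_def
  using assms by (intro the_equality) (auto intro: hilbert_space.ip_right_eqI)

text \<open>
  The two-sided norm bound replaces the Riesz representation theorem: were \<open>g\<close> to have no
  representing vector, neither would any nonzero multiple of \<open>g\<close>, and the adjoint would
  take the same junk value on all of them, which contradicts the bounds for small multiples.
\<close>

lemma hilbert_adjoint_represents:
  assumes H: "hilbert_space scaleH ipH" and K: "hilbert_space scaleK ipK"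
    and "0 < C" "0 < D"
    and lower: "\<And>r. C * (norm (r *\<^sub>R g))\<^sup>2 \<le> (norm (hilbert_adjoint ipH ipK T (r *\<^sub>R g)))\<^sup>2"
    and upper: "\<And>r. (norm (hilbert_adjoint ipH ipK T (r *\<^sub>R g)))\<^sup>2 \<le> D * (norm (r *\<^sub>R g))\<^sup>2"
  shows "ipK (T x) g = ipH x (hilbert_adjoint ipH ipK T g)"
proof (cases "\<exists>y. \<forall>x. ipK (T x) g = ipH x y")
  case True
  then obtain y where y: "\<And>x. ipK (T x) g = ipH x y"
    by blast
  then show ?thesis
    using hilbert_adjoint_eqI[OF H, of ipK T g y] by simp
next
  case False
  interpret H: hilbert_space scaleH ipH by (rule H)
  interpret K: hilbert_space scaleK ipK by (rule K)
  have "g \<noteq> 0"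
  proof
    assume "g = 0"
    then have "\<forall>x. ipK (T x) g = ipH x 0"
      by (simp add: H.ip_zero_right K.ip_zero_right)
    then show False
      using False by blast
  qed
  have no: "\<nexists>y. \<forall>x. ipK (T x) (r *\<^sub>R g) = ipH x y" if "r \<noteq> 0" for r
  proof
    assume "\<exists>y. \<forall>x. ipK (T x) (r *\<^sub>R g) = ipH x y"
    then obtain y where y: "\<And>x. ipK (T x) (r *\<^sub>R g) = ipH x y"
      by blast
    have "ipK (T x) g = ipH x ((1 / r) *\<^sub>R y)" for x
      using y[of x] that by (simp add: H.ip_scaleR_right K.ip_scaleR_right field_simps)
    then show False
      using False by blast
  qed
  \<comment> \<open>The defining predicate is identically false, so the description is literally the
    same term for every nonzero \<open>r\<close>.\<close>
  have junk: "hilbert_adjoint ipH ipK T (r *\<^sub>R g) = (THE y. False)" if "r \<noteq> 0" for r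
  proof -
    have "(\<lambda>y. \<forall>x. ipK (T x) (r *\<^sub>R g) = ipH x y) = (\<lambda>_. False)"
      using no[OF that] by (intro ext) simp
    then show ?thesis
      unfolding hilbert_adjoint_def by simp
  qed
  \<comment> \<open>With this \<open>r\<close> the upper bound at \<open>r *\<^sub>R g\<close> is
    half the lower bound at \<open>g\<close>, although both bound the norm of the same junk vector;
    this forces \<open>g = 0\<close>.\<close>
  define r where "r = sqrt (C / (2 * D))"
  have r: "r \<noteq> 0" "r\<^sup>2 = C / (2 * D)"
    using \<open>0 < C\<close> \<open>0 < D\<close> by (simp_all add: r_def)
  have "C * (norm g)\<^sup>2 \<le> D * (norm (r *\<^sub>R g))\<^sup>2"
    using lower[of 1] upper[of r] junk[of 1] junk[OF r(1)] by simp
  also have "\<dots> = C * (norm g)\<^sup>2 / 2"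
    using \<open>0 < D\<close> by (simp add: power_mult_distrib r(2))
  finally show ?thesis
    using \<open>0 < C\<close> \<open>g \<noteq> 0\<close> by simp
qed

lemma g_riesz_sequence_singleton:
  assumes "g_riesz_sequence ipH ipK V \<Theta> C D" and "g \<in> V i"
  shows "C * (norm g)\<^sup>2 \<le> (norm (hilbert_adjoint ipH ipK (\<Theta> i) g))\<^sup>2"
    and "(norm (hilbert_adjoint ipH ipK (\<Theta> i) g))\<^sup>2 \<le> D * (norm g)\<^sup>2"
proof -
  have "\<forall>J h. finite J \<longrightarrow> (\<forall>i\<in>J. h i \<in> V i) \<longrightarrow>
      C * (\<Sum>i\<in>J. (norm (h i))\<^sup>2) \<le> (norm (\<Sum>i\<in>J. hilbert_adjoint ipH ipK (\<Theta> i) (h i)))\<^sup>2 \<and>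
      (norm (\<Sum>i\<in>J. hilbert_adjoint ipH ipK (\<Theta> i) (h i)))\<^sup>2 \<le> D * (\<Sum>i\<in>J. (norm (h i))\<^sup>2)"
    using assms(1) unfolding g_riesz_sequence_def by blast
  from this[rule_format, of "{i}" "\<lambda>_. g"]
  show "C * (norm g)\<^sup>2 \<le> (norm (hilbert_adjoint ipH ipK (\<Theta> i) g))\<^sup>2"
    and "(norm (hilbert_adjoint ipH ipK (\<Theta> i) g))\<^sup>2 \<le> D * (norm g)\<^sup>2"
    using assms(2) by simp_all
qed

lemma closed_subspace_scaleR:
  assumes "hilbert_space scl ip" and "closed_subspace scl V" and "x \<in> V"
  shows "r *\<^sub>R x \<in> V"
proof -
  interpret hilbert_space scl ip by fact
  show ?thesis
    using assms(2,3) unfolding closed_subspace_def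
    by (simp add: scaleR_scale subspace_scale)
qed

lemma closed_subspace_zero:
  assumes "hilbert_space scl ip" and "closed_subspace scl V"
  shows "0 \<in> V"
proof -
  interpret hilbert_space scl ip by fact
  show ?thesis
    using assms(2) unfolding closed_subspace_def by (simp add: subspace_0)
qed

text \<open>The adjoint value of \<open>g\<close> does represent \<open>g\<close>, since the
  one-element case of the g-Riesz bounds holds at all real multiples of \<open>g\<close>. Its
  \<open>r\<close>-fold then represents the \<open>r\<close>-fold of \<open>g\<close>, and
  uniqueness finishes.\<close>

lemma g_riesz_sequence_adjoint_scaleR:
  assumes H: "hilbert_space scaleH ipH" and K: "hilbert_space scaleK ipK"
    and V: "closed_subspace scaleK (V i)"
    and riesz: "g_riesz_sequence ipH ipK V \<Theta> C D"
    and g: "g \<in> V i"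
  shows "hilbert_adjoint ipH ipK (\<Theta> i) (r *\<^sub>R g) = r *\<^sub>R hilbert_adjoint ipH ipK (\<Theta> i) g"
proof (rule hilbert_adjoint_eqI[OF H])
  fix x
  have "0 < C" "0 < D"
    using riesz unfolding g_riesz_sequence_def by auto
  then have "ipK (\<Theta> i x) g = ipH x (hilbert_adjoint ipH ipK (\<Theta> i) g)"
    by (rule hilbert_adjoint_represents[OF H K])
      (intro g_riesz_sequence_singleton[OF riesz] closed_subspace_scaleR[OF K V g])+
  then show "ipK (\<Theta> i x) (r *\<^sub>R g) = ipH x (r *\<^sub>R hilbert_adjoint ipH ipK (\<Theta> i) g)"
    by (simp add: hilbert_space.ip_scaleR_right[OF H] hilbert_space.ip_scaleR_right[OF K])
qed

section \<open>Unconditional convergence and norm bounds of the synthesis series\<close>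

text \<open>Cauchy criterion for the net of finite partial sums: beyond a large finite set the sums
  of \<open>w\<close> are small, and the square bound carries this over to the sums of
  \<open>f\<close>.\<close>

lemma summable_on_of_square_bound:
  fixes f :: "'i \<Rightarrow> 'b::banach"
  assumes w: "w summable_on A" and nonneg: "\<And>i. i \<in> A \<Longrightarrow> 0 \<le> (w i :: real)"
    and "0 < D"
    and bound: "\<And>J. finite J \<Longrightarrow> J \<subseteq> A \<Longrightarrow> (norm (sum f J))\<^sup>2 \<le> D * sum w J"
  shows "f summable_on A"
proof -
  have "\<exists>P. eventually P (finite_subsets_at_top A) \<and>
      (\<forall>F F'. P F \<and> P F' \<longrightarrow> dist (sum f F) (sum f F') < e)" if "e > 0" for e
  proof -
    \<comment> \<open>Chosen so that \<open>D * \<delta>\<close> is \<open>e\<^sup>2 / 8\<close>,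
      strictly below the square of \<open>e / 2\<close>.\<close>
    define \<delta> where "\<delta> = e\<^sup>2 / (8 * D)"
    have "\<delta> > 0"
      using that \<open>0 < D\<close> by (simp add: \<delta>_def)
    then obtain F0 where F0: "finite F0" "F0 \<subseteq> A" "dist (sum w F0) (infsum w A) \<le> \<delta>"
      using infsum_finite_approximation[OF w] by blast
    have near: "norm (sum f F - sum f F0) < e / 2" if F: "finite F" "F0 \<subseteq> F" "F \<subseteq> A" for F
    proof -
      have "sum w F \<le> infsum w A"
        using F nonneg by (intro finite_sum_le_infsum w) auto
      moreover have "sum w F = sum w (F - F0) + sum w F0"
        using F by (intro sum.subset_diff)
      ultimately have "sum w (F - F0) \<le> \<delta>"
        using F0(3) by (simp add: dist_real_def)
      have "(norm (sum f (F - F0)))\<^sup>2 \<le> D * sum w (F - F0)"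
        using F by (intro bound) auto
      also have "\<dots> \<le> D * \<delta>"
        using \<open>sum w (F - F0) \<le> \<delta>\<close> \<open>0 < D\<close> by simp
      also have "\<dots> < (e / 2)\<^sup>2"
        using \<open>e > 0\<close> \<open>0 < D\<close> by (simp add: \<delta>_def power_divide)
      finally have "norm (sum f (F - F0)) < e / 2"
        by (rule power2_less_imp_less) (use \<open>e > 0\<close> in simp)
      then show ?thesis
        by (simp only: sum_diff[OF F(1,2)])
    qed
    \<comment> \<open>Two finite sets containing \<open>F0\<close> are compared through the sum over
      \<open>F0\<close>, each at distance less than \<open>e / 2\<close>.\<close>
    let ?P = "\<lambda>F. finite F \<and> F0 \<subseteq> F \<and> F \<subseteq> A"
    have "eventually ?P (finite_subsets_at_top A)"
      using F0 unfolding eventually_finite_subsets_at_top by blast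
    moreover have "dist (sum f F) (sum f F') < e" if "?P F" "?P F'" for F F'
      using dist_triangle_half_l[of "sum f F" "sum f F0" e "sum f F'"] near[of F] near[of F'] that
      by (simp add: dist_norm norm_minus_commute)
    ultimately show ?thesis
      by (intro exI[of _ ?P] conjI allI impI) simp_all
  qed
  then have "cauchy_filter (filtermap (sum f) (finite_subsets_at_top A))"
    by (simp add: cauchy_filter_metric_filtermap)
  moreover have "complete (UNIV :: 'b set)"
    by (meson Cauchy_convergent UNIV_I complete_def convergent_def)
  ultimately obtain L where "(sum f \<longlongrightarrow> L) (finite_subsets_at_top A)"
    using complete_uniform[where S = UNIV] by (force simp add: filterlim_def)
  then show ?thesis
    using summable_on_def has_sum_def by blast
qed

text \<open>The squared norms are nonnegative, so summability of the ordered series is unordered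
  summability, which passes to every set of indices.\<close>

lemma l2_direct_sumD:
  assumes "g \<in> l2_direct_sum V"
  shows "g i \<in> V i" and "(\<lambda>i. (norm (g i))\<^sup>2) summable_on \<sigma>"
proof -
  have "(\<lambda>i. (norm (g i))\<^sup>2) summable_on UNIV"
    using assms by (intro summable_nonneg_imp_summable_on) (auto simp: l2_direct_sum_def)
  then show "(\<lambda>i. (norm (g i))\<^sup>2) summable_on \<sigma>"
    by (rule summable_on_subset_banach) simp
qed (use assms in \<open>simp add: l2_direct_sum_def\<close>)

lemma g_riesz_sequence_summable_on:
  assumes "g_riesz_sequence ipH ipK V \<Theta> C D" and "g \<in> l2_direct_sum V"
  shows "(\<lambda>i. hilbert_adjoint ipH ipK (\<Theta> i) (g i)) summable_on \<sigma>"
proof (rule summable_on_of_square_bound)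
  show "(\<lambda>i. (norm (g i))\<^sup>2) summable_on \<sigma>" "0 < D"
    using assms by (auto simp: l2_direct_sumD g_riesz_sequence_def)
qed (use assms in \<open>auto simp: l2_direct_sumD g_riesz_sequence_def\<close>)

text \<open>The bounds hold on every finite subset of \<open>\<sigma>\<close>; both sides converge
  along the net of these subsets, and weak inequalities survive the limit.\<close>

lemma g_riesz_sequence_synthesis:
  assumes riesz: "g_riesz_sequence ipH ipK V \<Theta> C D" and g: "g \<in> l2_direct_sum V"
  shows "C * (\<Sum>\<^sub>\<infinity>i\<in>\<sigma>. (norm (g i))\<^sup>2) \<le> (norm (synthesis ipH ipK \<Theta> \<sigma> g))\<^sup>2"
    and "(norm (synthesis ipH ipK \<Theta> \<sigma> g))\<^sup>2 \<le> D * (\<Sum>\<^sub>\<infinity>i\<in>\<sigma>. (norm (g i))\<^sup>2)"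
proof -
  let ?F = "finite_subsets_at_top \<sigma>"
  have w: "(sum (\<lambda>i. (norm (g i))\<^sup>2) \<longlongrightarrow> (\<Sum>\<^sub>\<infinity>i\<in>\<sigma>. (norm (g i))\<^sup>2)) ?F"
    by (intro infsum_tendsto l2_direct_sumD[OF g])
  have f: "(sum (\<lambda>i. hilbert_adjoint ipH ipK (\<Theta> i) (g i)) \<longlongrightarrow> synthesis ipH ipK \<Theta> \<sigma> g) ?F"
    unfolding synthesis_def by (intro infsum_tendsto g_riesz_sequence_summable_on[OF riesz g])
  have J: "eventually finite ?F"
    by (intro eventually_finite_subsets_at_top_weakI)
  show "C * (\<Sum>\<^sub>\<infinity>i\<in>\<sigma>. (norm (g i))\<^sup>2) \<le> (norm (synthesis ipH ipK \<Theta> \<sigma> g))\<^sup>2"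
  proof (rule tendsto_le[OF finite_subsets_at_top_neq_bot])
    show "eventually (\<lambda>J. C * (\<Sum>i\<in>J. (norm (g i))\<^sup>2)
        \<le> (norm (\<Sum>i\<in>J. hilbert_adjoint ipH ipK (\<Theta> i) (g i)))\<^sup>2) ?F"
      using J by (rule eventually_mono)
        (use riesz l2_direct_sumD(1)[OF g] in \<open>auto simp: g_riesz_sequence_def\<close>)
  qed (intro tendsto_intros w f)+
  show "(norm (synthesis ipH ipK \<Theta> \<sigma> g))\<^sup>2 \<le> D * (\<Sum>\<^sub>\<infinity>i\<in>\<sigma>. (norm (g i))\<^sup>2)"
  proof (rule tendsto_le[OF finite_subsets_at_top_neq_bot])
    show "eventually (\<lambda>J. (norm (\<Sum>i\<in>J. hilbert_adjoint ipH ipK (\<Theta> i) (g i)))\<^sup>2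
        \<le> D * (\<Sum>i\<in>J. (norm (g i))\<^sup>2)) ?F"
      using J by (rule eventually_mono)
        (use riesz l2_direct_sumD(1)[OF g] in \<open>auto simp: g_riesz_sequence_def\<close>)
  qed (intro tendsto_intros w f)+
qed

section \<open>Scaling, splitting and finite support of synthesized vectors\<close>

lemma synthesis_scaleR:
  assumes "hilbert_space scaleH ipH" and "hilbert_space scaleK ipK"
    and "\<And>i. closed_subspace scaleK (V i)"
    and "g_riesz_sequence ipH ipK V \<Theta> C D"
    and "g \<in> l2_direct_sum V"
  shows "synthesis ipH ipK \<Theta> \<sigma> (\<lambda>i. r *\<^sub>R g i) = r *\<^sub>R synthesis ipH ipK \<Theta> \<sigma> g"
  using g_riesz_sequence_adjoint_scaleR[OF assms(1-4) l2_direct_sumD(1)[OF assms(5)]]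
  by (simp add: synthesis_def infsum_scaleR_right)

lemma l2_direct_sum_scaleR:
  assumes "hilbert_space scaleK ipK" and "\<And>i. closed_subspace scaleK (V i)"
    and "g \<in> l2_direct_sum V"
  shows "(\<lambda>i. r *\<^sub>R g i) \<in> l2_direct_sum V"
  using assms(3) closed_subspace_scaleR[OF assms(1,2)]
  by (auto simp: l2_direct_sum_def power_mult_distrib intro: summable_mult)

lemma power2_norm_add_le:
  fixes x y :: "'a::real_normed_vector"
  shows "(norm (x + y))\<^sup>2 \<le> 2 * ((norm x)\<^sup>2 + (norm y)\<^sup>2)"
proof -
  have "(norm (x + y))\<^sup>2 \<le> (norm x + norm y)\<^sup>2"
    by (intro power_mono norm_triangle_ineq) simp
  also have "\<dots> \<le> 2 * ((norm x)\<^sup>2 + (norm y)\<^sup>2)"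
    using sum_squares_bound[of "norm x" "norm y"] by (simp add: power2_sum)
  finally show ?thesis .
qed

text \<open>The mixed family is not yet known to be a g-Riesz sequence. Its series converges because
  it agrees with that of \<Lambda> on \<sigma> and with that of \<Gamma> on the complement.\<close>

lemma synthesis_mixed:
  assumes "g_riesz_sequence ipH ipK V \<Lambda> A\<^sub>1 B\<^sub>1" and "g_riesz_sequence ipH ipK V \<Gamma> A\<^sub>2 B\<^sub>2"
    and "g \<in> l2_direct_sum V"
  shows "synthesis ipH ipK (\<lambda>i. if i \<in> \<sigma> then \<Lambda> i else \<Gamma> i) UNIV g
    = synthesis ipH ipK \<Lambda> \<sigma> g + synthesis ipH ipK \<Gamma> (- \<sigma>) g"
proof -
  let ?f = "\<lambda>i. hilbert_adjoint ipH ipK (if i \<in> \<sigma> then \<Lambda> i else \<Gamma> i) (g i)"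
  have "?f summable_on \<sigma>"
    using g_riesz_sequence_summable_on[OF assms(1,3), of \<sigma>]
    by (rule summable_on_cong[THEN iffD1, rotated]) simp
  moreover have "?f summable_on - \<sigma>"
    using g_riesz_sequence_summable_on[OF assms(2,3), of "- \<sigma>"]
    by (rule summable_on_cong[THEN iffD1, rotated]) simp
  ultimately have "infsum ?f (\<sigma> \<union> - \<sigma>) = infsum ?f \<sigma> + infsum ?f (- \<sigma>)"
    by (intro infsum_Un_disjoint) auto
  also have "\<dots> = synthesis ipH ipK \<Lambda> \<sigma> g + synthesis ipH ipK \<Gamma> (- \<sigma>) g"
    unfolding synthesis_def by (intro arg_cong2[of _ _ _ _ plus] infsum_cong) auto
  finally show ?thesis
    by (simp add: synthesis_def)
qed

text \<open>This links the infinite sums in (3) with the finite sums in the definition of a g-Riesz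
  sequence.\<close>

lemma synthesis_finite_support:
  assumes "finite J" and "\<And>i. i \<in> \<sigma> - J \<Longrightarrow> hilbert_adjoint ipH ipK (\<Theta> i) (g i) = 0"
  shows "synthesis ipH ipK \<Theta> \<sigma> g = (\<Sum>i\<in>J \<inter> \<sigma>. hilbert_adjoint ipH ipK (\<Theta> i) (g i))"
proof -
  have "synthesis ipH ipK \<Theta> \<sigma> g = (\<Sum>\<^sub>\<infinity>i\<in>J \<inter> \<sigma>. hilbert_adjoint ipH ipK (\<Theta> i) (g i))"
    unfolding synthesis_def using assms(2) by (intro infsum_cong_neutral) auto
  then show ?thesis
    using assms(1) by simp
qed

section \<open>Equivalence of the four lower estimates for the mixed families\<close>

theorem theorem4p5:
  fixes scaleH :: "'f::hilbert_scalar \<Rightarrow> 'h::banach \<Rightarrow> 'h"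
    and ipH :: "'h \<Rightarrow> 'h \<Rightarrow> 'f"
    and scaleK :: "'f \<Rightarrow> 'k::banach \<Rightarrow> 'k"
    and ipK :: "'k \<Rightarrow> 'k \<Rightarrow> 'f"
    and V :: "nat \<Rightarrow> 'k set"
    and \<Lambda> \<Gamma> :: "nat \<Rightarrow> 'h \<Rightarrow> 'k"
    and A\<^sub>1 B\<^sub>1 A\<^sub>2 B\<^sub>2 :: real
  assumes "hilbert_space scaleH ipH"
    and "hilbert_space scaleK ipK"
    and "\<And>i. closed_subspace scaleK (V i)"
    and "\<And>i. \<Lambda> i \<in> bounded_operators scaleH scaleK (V i)"
    and "\<And>i. \<Gamma> i \<in> bounded_operators scaleH scaleK (V i)"
    and "g_riesz_sequence ipH ipK V \<Lambda> A\<^sub>1 B\<^sub>1"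
    and "g_riesz_sequence ipH ipK V \<Gamma> A\<^sub>2 B\<^sub>2"
  shows
    "let
       S\<Lambda> = synthesis ipH ipK \<Lambda>;
       S\<Gamma> = synthesis ipH ipK \<Gamma>;
       P1 = (\<exists>B C. 0 < B \<and> B \<le> C \<and>
         (\<forall>\<sigma>. g_riesz_sequence ipH ipK V (\<lambda>i. if i \<in> \<sigma> then \<Lambda> i else \<Gamma> i) B C));
       P2 = (\<exists>A>0. \<forall>g\<in>l2_direct_sum V. \<forall>\<sigma>.
         A * (norm (S\<Lambda> \<sigma> g))\<^sup>2 \<le> (norm (S\<Lambda> \<sigma> g + S\<Gamma> (- \<sigma>) g))\<^sup>2);
       P3 = (\<exists>D>0. \<forall>g\<in>l2_direct_sum V. \<forall>\<sigma>.
         D * ((norm (S\<Lambda> \<sigma> g))\<^sup>2 + (norm (S\<Gamma> (- \<sigma>) g))\<^sup>2)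
           \<le> (norm (S\<Lambda> \<sigma> g + S\<Gamma> (- \<sigma>) g))\<^sup>2);
       P4 = (\<exists>E>0. \<forall>g\<in>l2_direct_sum V. \<forall>\<sigma>.
         norm (S\<Lambda> \<sigma> g) = 1 \<longrightarrow> E \<le> (norm (S\<Lambda> \<sigma> g + S\<Gamma> (- \<sigma>) g))\<^sup>2)
     in (P1 \<longleftrightarrow> P2) \<and> (P2 \<longleftrightarrow> P3) \<and> (P3 \<longleftrightarrow> P4)"
proof -
  note H = assms(1) and K = assms(2) and V = assms(3) and \<Lambda> = assms(6) and \<Gamma> = assms(7)
  define S\<Lambda> where "S\<Lambda> = synthesis ipH ipK \<Lambda>"
  define S\<Gamma> where "S\<Gamma> = synthesis ipH ipK \<Gamma>"
  let ?mix = "\<lambda>\<sigma> i. if i \<in> \<sigma> then \<Lambda> i else \<Gamma> i"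
  let ?P1 = "\<exists>B C. 0 < B \<and> B \<le> C \<and> (\<forall>\<sigma>. g_riesz_sequence ipH ipK V (?mix \<sigma>) B C)"
  let ?P2 = "\<exists>A>0. \<forall>g\<in>l2_direct_sum V. \<forall>\<sigma>.
      A * (norm (S\<Lambda> \<sigma> g))\<^sup>2 \<le> (norm (S\<Lambda> \<sigma> g + S\<Gamma> (- \<sigma>) g))\<^sup>2"
  let ?P3 = "\<exists>D>0. \<forall>g\<in>l2_direct_sum V. \<forall>\<sigma>.
      D * ((norm (S\<Lambda> \<sigma> g))\<^sup>2 + (norm (S\<Gamma> (- \<sigma>) g))\<^sup>2) \<le> (norm (S\<Lambda> \<sigma> g + S\<Gamma> (- \<sigma>) g))\<^sup>2"
  let ?P4 = "\<exists>E>0. \<forall>g\<in>l2_direct_sum V. \<forall>\<sigma>.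
      norm (S\<Lambda> \<sigma> g) = 1 \<longrightarrow> E \<le> (norm (S\<Lambda> \<sigma> g + S\<Gamma> (- \<sigma>) g))\<^sup>2"
  have pos: "0 < A\<^sub>1" "0 < B\<^sub>1" "0 < A\<^sub>2" "0 < B\<^sub>2"
    using \<Lambda> \<Gamma> by (auto simp: g_riesz_sequence_def)
  have P12: ?P2 if prem: ?P1
  proof -
    obtain B C where "0 < B" and BC: "\<And>\<sigma>. g_riesz_sequence ipH ipK V (?mix \<sigma>) B C"
      using prem by blast
    \<comment> \<open>Dividing by \<open>B\<^sub>1\<close> cancels the upper bound of \<Lambda>.
      Enlarging \<sigma> to all indices then makes the lower bound of the mixed family
      applicable.\<close>
    have "B / B\<^sub>1 * (norm (S\<Lambda> \<sigma> g))\<^sup>2 \<le> (norm (S\<Lambda> \<sigma> g + S\<Gamma> (- \<sigma>) g))\<^sup>2"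
      if g: "g \<in> l2_direct_sum V" for g \<sigma>
    proof -
      have "B / B\<^sub>1 * (norm (S\<Lambda> \<sigma> g))\<^sup>2 \<le> B / B\<^sub>1 * (B\<^sub>1 * (\<Sum>\<^sub>\<infinity>i\<in>\<sigma>. (norm (g i))\<^sup>2))"
        unfolding S\<Lambda>_def using \<open>0 < B\<close> pos
        by (intro mult_left_mono g_riesz_sequence_synthesis(2)[OF \<Lambda> g]) simp
      also have "\<dots> = B * (\<Sum>\<^sub>\<infinity>i\<in>\<sigma>. (norm (g i))\<^sup>2)"
        using pos by simp
      also have "\<dots> \<le> B * (\<Sum>\<^sub>\<infinity>i. (norm (g i))\<^sup>2)"
        using \<open>0 < B\<close> by (intro mult_left_mono infsum_mono2 l2_direct_sumD[OF g]) auto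
      also have "\<dots> \<le> (norm (synthesis ipH ipK (?mix \<sigma>) UNIV g))\<^sup>2"
        by (rule g_riesz_sequence_synthesis(1)[OF BC g])
      also have "\<dots> = (norm (S\<Lambda> \<sigma> g + S\<Gamma> (- \<sigma>) g))\<^sup>2"
        unfolding S\<Lambda>_def S\<Gamma>_def synthesis_mixed[OF \<Lambda> \<Gamma> g] ..
      finally show ?thesis .
    qed
    then show ?thesis
      using \<open>0 < B\<close> pos by (intro exI[of _ "B / B\<^sub>1"]) auto
  qed
  have P23: ?P3 if prem: ?P2
  proof -
    obtain A where "0 < A" and A: "\<And>g \<sigma>. g \<in> l2_direct_sum V \<Longrightarrow>
        A * (norm (S\<Lambda> \<sigma> g))\<^sup>2 \<le> (norm (S\<Lambda> \<sigma> g + S\<Gamma> (- \<sigma>) g))\<^sup>2"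
      using prem by blast
    \<comment> \<open>Writing a, b, s for the squared norms of the two parts and of their sum, b is
      at most 2(s + a), so a + b is at most 2s + 3a. Multiplying by \<open>A\<close> and using that
      \<open>A\<close> times a is at most s leaves the factor 2\<open>A\<close> + 3.\<close>
    define D where "D = A / (2 * A + 3)"
    have "D * ((norm (S\<Lambda> \<sigma> g))\<^sup>2 + (norm (S\<Gamma> (- \<sigma>) g))\<^sup>2) \<le> (norm (S\<Lambda> \<sigma> g + S\<Gamma> (- \<sigma>) g))\<^sup>2"
      (is "D * (?a + ?b) \<le> ?s") if g: "g \<in> l2_direct_sum V" for g \<sigma>
    proof -
      \<comment> \<open>The \<Gamma> part is the full sum minus the \<Lambda> part.\<close>
      have "?b \<le> 2 * (?s + ?a)"
        using power2_norm_add_le[of "S\<Lambda> \<sigma> g + S\<Gamma> (- \<sigma>) g" "- S\<Lambda> \<sigma> g"] by simp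
      then have "A * (?a + ?b) \<le> A * (2 * ?s + 3 * ?a)"
        using \<open>0 < A\<close> by simp
      also have "\<dots> \<le> (2 * A + 3) * ?s"
        using A[OF g, of \<sigma>] by (simp add: algebra_simps)
      finally show ?thesis
        using \<open>0 < A\<close> by (simp add: D_def pos_divide_le_eq mult.commute)
    qed
    moreover have "0 < D"
      using \<open>0 < A\<close> by (simp add: D_def)
    ultimately show ?thesis
      by blast
  qed
  have P31: ?P1 if prem: ?P3
  proof -
    obtain D where "0 < D" and D: "\<And>g \<sigma>. g \<in> l2_direct_sum V \<Longrightarrow>
        D * ((norm (S\<Lambda> \<sigma> g))\<^sup>2 + (norm (S\<Gamma> (- \<sigma>) g))\<^sup>2) \<le> (norm (S\<Lambda> \<sigma> g + S\<Gamma> (- \<sigma>) g))\<^sup>2"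
      using prem by blast
    \<comment> \<open>The factor 2 comes from \<open>power2_norm_add_le\<close>, applied to the two
      parts of a finite mixed sum.\<close>
    define C where "C = 2 * max B\<^sub>1 B\<^sub>2"
    \<comment> \<open>The estimate itself yields \<open>D * min A\<^sub>1 A\<^sub>2\<close>; the
      outer minimum with \<open>C\<close> secures the required order of the two bounds.\<close>
    define B where "B = min (D * min A\<^sub>1 A\<^sub>2) C"
    have B: "0 < B" "B \<le> C" "B \<le> D * min A\<^sub>1 A\<^sub>2"
      using \<open>0 < D\<close> pos by (auto simp: B_def C_def)
    have "B * (\<Sum>i\<in>J. (norm (g i))\<^sup>2) \<le> (norm (\<Sum>i\<in>J. hilbert_adjoint ipH ipK (?mix \<sigma> i) (g i)))\<^sup>2 \<and>
        (norm (\<Sum>i\<in>J. hilbert_adjoint ipH ipK (?mix \<sigma> i) (g i)))\<^sup>2 \<le> C * (\<Sum>i\<in>J. (norm (g i))\<^sup>2)"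
      if J: "finite J" and g: "\<forall>i\<in>J. g i \<in> V i" for J g \<sigma>
    proof -
      \<comment> \<open>Condition (3) speaks of full sequences in the direct sum, so the finite
        family is extended by zero, which lies in every subspace.\<close>
      define h where "h = (\<lambda>i. if i \<in> J then g i else 0)"
      have zero: "0 \<in> V i" for i
        by (rule closed_subspace_zero[OF K V])
      have h: "h \<in> l2_direct_sum V"
        unfolding l2_direct_sum_def h_def using J g zero
        by (auto intro: summable_finite[of J])
      \<comment> \<open>The upper g-Riesz bound at the zero vector forces the adjoint value to
        vanish.\<close>
      have adjoint_zero: "hilbert_adjoint ipH ipK (\<Theta> i) 0 = 0"
        if "g_riesz_sequence ipH ipK V \<Theta> C' D'" for \<Theta> i C' D'
        using g_riesz_sequence_singleton(2)[OF that zero] by simp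
      define a where "a = (\<Sum>i\<in>J \<inter> \<sigma>. hilbert_adjoint ipH ipK (\<Lambda> i) (g i))"
      define b where "b = (\<Sum>i\<in>J \<inter> - \<sigma>. hilbert_adjoint ipH ipK (\<Gamma> i) (g i))"
      define p where "p = (\<Sum>i\<in>J \<inter> \<sigma>. (norm (g i))\<^sup>2)"
      define q where "q = (\<Sum>i\<in>J \<inter> - \<sigma>. (norm (g i))\<^sup>2)"
      have nonneg: "0 \<le> p" "0 \<le> q"
        by (simp_all add: p_def q_def sum_nonneg)
      have "S\<Lambda> \<sigma> h = a" "S\<Gamma> (- \<sigma>) h = b"
        unfolding S\<Lambda>_def S\<Gamma>_def a_def b_def
        by (subst synthesis_finite_support[OF J];
            simp add: h_def adjoint_zero[OF \<Lambda>] adjoint_zero[OF \<Gamma>])+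
      then have ab: "D * ((norm a)\<^sup>2 + (norm b)\<^sup>2) \<le> (norm (a + b))\<^sup>2"
        using D[OF h, of \<sigma>] by simp
      \<comment> \<open>Kept generic in the type of the summands because it splits both the vector
        sum and the sum of squared norms.\<close>
      have split: "sum f J = sum f (J \<inter> \<sigma>) + sum f (J \<inter> - \<sigma>)"
        for f :: "nat \<Rightarrow> 'z::comm_monoid_add"
        using sum.Int_Diff[OF J, of f \<sigma>] by (simp add: Diff_eq)
      have mix: "(\<Sum>i\<in>J. hilbert_adjoint ipH ipK (?mix \<sigma> i) (g i)) = a + b"
        unfolding split a_def b_def by (intro arg_cong2[of _ _ _ _ plus] sum.cong) auto
      have pq: "(\<Sum>i\<in>J. (norm (g i))\<^sup>2) = p + q"
        unfolding split p_def q_def ..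
      have a: "A\<^sub>1 * p \<le> (norm a)\<^sup>2" "(norm a)\<^sup>2 \<le> B\<^sub>1 * p"
        using \<Lambda> J g unfolding g_riesz_sequence_def a_def p_def by auto
      have b: "A\<^sub>2 * q \<le> (norm b)\<^sup>2" "(norm b)\<^sup>2 \<le> B\<^sub>2 * q"
        using \<Gamma> J g unfolding g_riesz_sequence_def b_def q_def by auto
      \<comment> \<open>The lower bounds of \<Lambda> and \<Gamma> are used separately on the two
        pieces of \<open>J\<close>, and (3) joins the pieces.\<close>
      have "B * (p + q) \<le> D * min A\<^sub>1 A\<^sub>2 * (p + q)"
        using B nonneg by (intro mult_right_mono) auto
      also have "\<dots> \<le> D * (A\<^sub>1 * p + A\<^sub>2 * q)"
        using \<open>0 < D\<close> nonneg by (simp add: distrib_left mult.assoc mult_right_mono add_mono)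
      also have "\<dots> \<le> D * ((norm a)\<^sup>2 + (norm b)\<^sup>2)"
        using \<open>0 < D\<close> a(1) b(1) by (intro mult_left_mono add_mono) auto
      also note ab
      finally have lower: "B * (p + q) \<le> (norm (a + b))\<^sup>2" .
      have "(norm (a + b))\<^sup>2 \<le> 2 * (B\<^sub>1 * p + B\<^sub>2 * q)"
        using a(2) b(2) by (intro order_trans[OF power2_norm_add_le] mult_left_mono add_mono) auto
      also have "\<dots> \<le> C * (p + q)"
        using nonneg by (simp add: C_def distrib_left mult_right_mono add_mono)
      finally show ?thesis
        using lower unfolding mix pq by blast
    qed
    then have "\<forall>\<sigma>. g_riesz_sequence ipH ipK V (?mix \<sigma>) B C"
      using B unfolding g_riesz_sequence_def by auto
    then show ?thesis
      using B by blast
  qed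
  \<comment> \<open>The cycle through (1) already contains this implication.\<close>
  have P32: ?P2 if prem: ?P3
    using P12[OF P31[OF prem]] .
  have P24: ?P4 if prem: ?P2
  proof -
    obtain A where "0 < A" and A: "\<And>g \<sigma>. g \<in> l2_direct_sum V \<Longrightarrow>
        A * (norm (S\<Lambda> \<sigma> g))\<^sup>2 \<le> (norm (S\<Lambda> \<sigma> g + S\<Gamma> (- \<sigma>) g))\<^sup>2"
      using prem by blast
    have "A \<le> (norm (S\<Lambda> \<sigma> g + S\<Gamma> (- \<sigma>) g))\<^sup>2"
      if "g \<in> l2_direct_sum V" "norm (S\<Lambda> \<sigma> g) = 1" for g \<sigma>
      using A[OF that(1), of \<sigma>] that(2) by simp
    then show ?thesis
      using \<open>0 < A\<close> by blast
  qed
  have P42: ?P2 if prem: ?P4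
  proof -
    obtain E where "0 < E" and E: "\<And>g \<sigma>. g \<in> l2_direct_sum V \<Longrightarrow> norm (S\<Lambda> \<sigma> g) = 1 \<Longrightarrow>
        E \<le> (norm (S\<Lambda> \<sigma> g + S\<Gamma> (- \<sigma>) g))\<^sup>2"
      using prem by blast
    have "E * (norm (S\<Lambda> \<sigma> g))\<^sup>2 \<le> (norm (S\<Lambda> \<sigma> g + S\<Gamma> (- \<sigma>) g))\<^sup>2"
      if g: "g \<in> l2_direct_sum V" for g \<sigma>
    proof (cases "S\<Lambda> \<sigma> g = 0")
      case False
      \<comment> \<open>Scaling all coefficients by \<open>r\<close> makes the \<Lambda> part a unit
        vector and multiplies the full sum by \<open>r\<close> as well. Undoing the scaling in (4)
        gives (2) with the same constant \<open>E\<close>; a vanishing \<Lambda> part makes (2)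
        trivial.\<close>
      define r where "r = 1 / norm (S\<Lambda> \<sigma> g)"
      have scale: "S\<Lambda> \<sigma> (\<lambda>i. r *\<^sub>R g i) = r *\<^sub>R S\<Lambda> \<sigma> g"
          "S\<Gamma> (- \<sigma>) (\<lambda>i. r *\<^sub>R g i) = r *\<^sub>R S\<Gamma> (- \<sigma>) g"
        unfolding S\<Lambda>_def S\<Gamma>_def
        by (rule synthesis_scaleR[OF H K V \<Lambda> g], rule synthesis_scaleR[OF H K V \<Gamma> g])
      have "E \<le> (norm (r *\<^sub>R S\<Lambda> \<sigma> g + r *\<^sub>R S\<Gamma> (- \<sigma>) g))\<^sup>2"
        using E[OF l2_direct_sum_scaleR[OF K V g], of \<sigma> r] False unfolding scale
        by (simp add: r_def)
      also have "\<dots> = (norm (S\<Lambda> \<sigma> g + S\<Gamma> (- \<sigma>) g))\<^sup>2 / (norm (S\<Lambda> \<sigma> g))\<^sup>2"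
        by (simp add: r_def power_divide flip: scaleR_add_right)
      finally show ?thesis
        using False by (simp add: pos_le_divide_eq)
    qed simp
    then show ?thesis
      using \<open>0 < E\<close> by blast
  qed
  have "(?P1 \<longleftrightarrow> ?P2) \<and> (?P2 \<longleftrightarrow> ?P3) \<and> (?P3 \<longleftrightarrow> ?P4)"
    using P12 P23 P31 P32 P24 P42 by argo
  then show ?thesis
    unfolding Let_def S\<Lambda>_def S\<Gamma>_def .
qed

end
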